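(* Let $(\mathbb{L}, I)$ be a set of lines with an incidence relation satisfying Axioms [1]–[4] and the assumption of projectivity. Then two distinct reguli can have at most two lines in common; that is, if $R_1 \neq R_2$ are reguli (as subsets of $\mathbb{L}$) then $R_1 \cap R_2$ contains at most two lines.
   Context: Framework. $\mathbb{L}$ is a set whose elements are called lines, equipped with a symmetric reflexive relation $I$ called incidence ("$a$ meets $b$" means $a \, I \, b$). For $S \subseteq \mathbb{L}$, $S^{I}$ denotes the set of all lines incident to each line in $S$; write $l^{I} = \{l\}^{I}$, $[l_1 \dots l_n] = \{l_1,\dots,l_n\}^{I}$ and $[ab]^{I} = ([ab])^{I}$. Lines $a, b$ are skew if they are not incident; a skew pair in a set is a pair of skew lines both in the set. The axioms are as follows. Axiom [1]: for each line $l$ the set $l^{I}$ contains three pairwise skew lines. Axiom [2]: for each incident pair of distinct lines $a, b$: [2.1] $[ab]$ contains skew pairs of lines; [2.2] if $c \in [ab] \setminus [ab]^{I}$ (i.e. $c$ is one of a skew pair in $[ab]$) then $[abc]$ contains no skew pairs; [2.3] if $x, y$ is a skew pair in $[ab]$ then $[ab] = [abx] \cup [aby]$. Axiom [3]: if $a, b$ is an incident pair of distinct lines and $c \in [ab] \setminus [ab]^{I}$, then there exist an incident pair of distinct lines $p, q$ and $r \in [pq] \setminus [pq]^{I}$ such that $[abc] \cap [pqr] = \emptyset$. Points and planes: for distinct incident $a, b$, incidence restricts to an equivalence relation on $\Sigma(a,b) = [ab] \setminus [ab]^{I}$ with exactly two classes. These classes are labelled $\Sigma_{\curlyvee}(a,b)$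 and $\Sigma_{\triangledown}(a,b)$ (one labelling fixed for each unordered pair $\{a,b\}$, so that Axiom [4] holds). The set $a \curlyvee b = [abc]$ for any $c \in \Sigma_{\curlyvee}(a,b)$ is independent of the choice of $c$ and is called a point; the set $a \triangledown b = [abc]$ for any $c \in \Sigma_{\triangledown}(a,b)$ is independent of the choice of $c$ and is called a plane. Axiom [4]: whenever $a, b$ and $p, q$ are pairs of distinct incident lines, $(a \curlyvee b) \cap (p \curlyvee q) \neq \emptyset$ and $(a \triangledown b) \cap (p \triangledown q) \neq \emptyset$. Regulus: a regulus is a set of the form $[uvw]$ where $u, v, w$ are pairwise skew lines. Assumption of projectivity: for all pairwise skew lines $u, v, w$ and all distinct lines $a, b, c, d \in [uvw]$, if a line meets three of $a, b, c, d$ then it meets the fourth. (Equivalently: for all pairwise skew $u, v, w$ and distinct $x, y, z \in [uvw]$, every $l \in [uvw]$ meets every $m \in [xyz]$.) *)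

theory Defs
  imports Main
begin

locale line_incidence =
  fixes L :: "'a set" and I :: "'a \<Rightarrow> 'a \<Rightarrow> bool"
  assumes incident_refl: "reflp_on L I"
    and incident_sym: "symp_on L I"
begin

definition skew :: "'a \<Rightarrow> 'a \<Rightarrow> bool" where
  "skew a b \<longleftrightarrow> a \<in> L \<and> b \<in> L \<and> \<not> I a b"

definition has_skew_pair :: "'a set \<Rightarrow> bool" where
  "has_skew_pair S \<longleftrightarrow> (\<exists>x\<in>S. \<exists>y\<in>S. skew x y)"

definition pairwise_skew :: "'a \<Rightarrow> 'a \<Rightarrow> 'a \<Rightarrow> bool" where
  "pairwise_skew u v w \<longleftrightarrow> skew u v \<and> skew u w \<and> skew v w"

definition incident_pair :: "'a \<Rightarrow> 'a \<Rightarrow> bool" where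
  "incident_pair a b \<longleftrightarrow> a \<in> L \<and> b \<in> L \<and> a \<noteq> b \<and> I a b"

text \<open>The set usually written \<open>S\<^sup>I\<close>; thus \<open>[a b c]\<close> is \<open>transversals {a, b, c}\<close>.\<close>

definition transversals :: "'a set \<Rightarrow> 'a set" where
  "transversals S = {x \<in> L. \<forall>s\<in>S. I x s}"

definition Sig :: "'a \<Rightarrow> 'a \<Rightarrow> 'a set" where
  "Sig a b = transversals {a, b} - transversals (transversals {a, b})"

definition Sig_rel :: "'a \<Rightarrow> 'a \<Rightarrow> ('a \<times> 'a) set" where
  "Sig_rel a b = {(x, y). x \<in> Sig a b \<and> y \<in> Sig a b \<and> I x y}"

definition regulus :: "'a set \<Rightarrow> bool" where
  "regulus R \<longleftrightarrow> (\<exists>u v w. pairwise_skew u v w \<and> R = transversals {u, v, w})"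

end

locale line_geometry = line_incidence +
  assumes ax1: "l \<in> L \<Longrightarrow>
      \<exists>x\<in>transversals {l}. \<exists>y\<in>transversals {l}. \<exists>z\<in>transversals {l}. pairwise_skew x y z"
    and ax2_1: "incident_pair a b \<Longrightarrow> has_skew_pair (transversals {a, b})"
    and ax2_2: "\<lbrakk>incident_pair a b; c \<in> Sig a b\<rbrakk> \<Longrightarrow> \<not> has_skew_pair (transversals {a, b, c})"
    and ax2_3: "\<lbrakk>incident_pair a b; x \<in> transversals {a, b}; y \<in> transversals {a, b}; skew x y\<rbrakk>
      \<Longrightarrow> transversals {a, b} = transversals {a, b, x} \<union> transversals {a, b, y}"
    and ax3: "\<lbrakk>incident_pair a b; c \<in> Sig a b\<rbrakk> \<Longrightarrow>
      \<exists>p q r. incident_pair p q \<and> r \<in> Sig p q \<and>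
        transversals {a, b, c} \<inter> transversals {p, q, r} = {}"
begin

lemma in_SigE:
  assumes "c \<in> Sig a b"
  obtains d where "d \<in> transversals {a, b}" "skew c d"
  using assms by (auto simp: Sig_def transversals_def skew_def)

lemma in_SigI:
  assumes "x \<in> transversals {a, b}" "y \<in> transversals {a, b}" "skew x y"
  shows "x \<in> Sig a b" "y \<in> Sig a b"
  using assms incident_sym by (auto simp: Sig_def transversals_def skew_def dest: symp_onD)

lemma equiv_Sig_rel:
  assumes "incident_pair a b"
  shows "equiv (Sig a b) (Sig_rel a b)"
proof (rule equivI)
  show "Sig_rel a b \<subseteq> Sig a b \<times> Sig a b" by (auto simp: Sig_rel_def)
  have sub: "Sig a b \<subseteq> L" by (auto simp: Sig_def transversals_def)
  show "refl_on (Sig a b) (Sig_rel a b)"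
    using incident_refl sub by (auto simp: refl_on_def Sig_rel_def dest: reflp_onD)
  show "sym (Sig_rel a b)"
    using incident_sym sub by (auto simp: sym_def Sig_rel_def dest: symp_onD)
  show "trans (Sig_rel a b)"
  proof (rule transI)
    fix x y z assume *: "(x, y) \<in> Sig_rel a b" "(y, z) \<in> Sig_rel a b"
    then have "x \<in> transversals {a, b, y}" "z \<in> transversals {a, b, y}" "y \<in> Sig a b"
      using sub incident_sym by (auto simp: Sig_rel_def Sig_def transversals_def dest: symp_onD)
    with ax2_2[OF assms, of y] have "I x z"
      by (auto simp: has_skew_pair_def skew_def transversals_def)
    with * show "(x, z) \<in> Sig_rel a b" by (auto simp: Sig_rel_def)
  qed
qed

lemma two_classes:
  assumes ab: "incident_pair a b"
  shows "\<exists>A B. A \<noteq> B \<and> Sig a b // Sig_rel a b = {A, B}"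
proof -
  obtain x y where xy: "x \<in> transversals {a, b}" "y \<in> transversals {a, b}" "skew x y"
    using ax2_1[OF ab] by (auto simp: has_skew_pair_def)
  let ?R = "Sig_rel a b"
  note S = in_SigI[OF xy]
  note eq = equiv_Sig_rel[OF ab]
  have "?R `` {x} \<noteq> ?R `` {y}"
    using xy(3) S eq_equiv_class_iff[OF eq S] by (auto simp: Sig_rel_def skew_def)
  moreover have "?R `` {z} = ?R `` {x} \<or> ?R `` {z} = ?R `` {y}" if z: "z \<in> Sig a b" for z
  proof -
    have "z \<in> transversals {a, b, x} \<union> transversals {a, b, y}"
      using z ax2_3[OF ab xy] by (auto simp: Sig_def)
    then have "I z x \<or> I z y" by (auto simp: transversals_def)
    then show ?thesis
      using z S eq_equiv_class_iff[OF eq] by (auto simp: Sig_rel_def)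
  qed
  ultimately show ?thesis
    using S by (intro exI[of _ "?R `` {x}"] exI[of _ "?R `` {y}"]) (auto simp: quotient_def)
qed

end

text \<open>
  A labelling of the two classes of each \<open>Sig a b\<close>: \<open>Pt a b\<close> is the class defining the point,
  \<open>Pl a b\<close> the class defining the plane. Only its values on pairs of distinct incident lines matter.
\<close>

locale labelled_line_geometry = line_geometry L I
  for L :: "'a set" and I +
  fixes Pt Pl :: "'a \<Rightarrow> 'a \<Rightarrow> 'a set"
  assumes classes: "incident_pair a b \<Longrightarrow> Sig a b // Sig_rel a b = {Pt a b, Pl a b}"
    and classes_distinct: "incident_pair a b \<Longrightarrow> Pt a b \<noteq> Pl a b"
    and unordered: "incident_pair a b \<Longrightarrow> Pt a b = Pt b a \<and> Pl a b = Pl b a"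
begin

text \<open>The choice of representative is immaterial, see \<open>pt_eq\<close> and \<open>pl_eq\<close> below.\<close>

definition pt :: "'a \<Rightarrow> 'a \<Rightarrow> 'a set" where
  "pt a b = transversals {a, b, SOME c. c \<in> Pt a b}"

definition pl :: "'a \<Rightarrow> 'a \<Rightarrow> 'a set" where
  "pl a b = transversals {a, b, SOME c. c \<in> Pl a b}"

lemma transversals_class_mono:
  assumes ab: "incident_pair a b" and C: "C \<in> Sig a b // Sig_rel a b" "c \<in> C" "d \<in> C"
  shows "transversals {a, b, c} \<subseteq> transversals {a, b, d}"
proof -
  have cd: "c \<in> Sig a b" "d \<in> Sig a b" "I d c"
    using quotient_eq_iff[OF equiv_Sig_rel[OF ab] C(1) C(1) C(3) C(2)]
    by (auto simp: Sig_rel_def)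
  then have d: "d \<in> transversals {a, b, c}" by (auto simp: Sig_def transversals_def)
  show ?thesis
  proof
    fix x assume x: "x \<in> transversals {a, b, c}"
    with d ax2_2[OF ab cd(1)] have "I x d"
      by (auto simp: has_skew_pair_def skew_def transversals_def)
    with x show "x \<in> transversals {a, b, d}" by (auto simp: transversals_def)
  qed
qed

lemma pt_eq:
  assumes "incident_pair a b" "c \<in> Pt a b"
  shows "pt a b = transversals {a, b, c}"
proof -
  have "(SOME c. c \<in> Pt a b) \<in> Pt a b" using assms(2) by (rule someI)
  moreover have "Pt a b \<in> Sig a b // Sig_rel a b" using classes[OF assms(1)] by simp
  ultimately show ?thesis
    using transversals_class_mono[OF assms(1)] assms(2) unfolding pt_def by blast
qed

lemma pl_eq:
  assumes "incident_pair a b" "c \<in> Pl a b"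
  shows "pl a b = transversals {a, b, c}"
proof -
  have "(SOME c. c \<in> Pl a b) \<in> Pl a b" using assms(2) by (rule someI)
  moreover have "Pl a b \<in> Sig a b // Sig_rel a b" using classes[OF assms(1)] by simp
  ultimately show ?thesis
    using transversals_class_mono[OF assms(1)] assms(2) unfolding pl_def by blast
qed

end

locale projective_line_geometry = labelled_line_geometry +
  assumes ax4: "\<lbrakk>incident_pair a b; incident_pair p q\<rbrakk> \<Longrightarrow>
      pt a b \<inter> pt p q \<noteq> {} \<and> pl a b \<inter> pl p q \<noteq> {}"
    and projectivity: "\<lbrakk>pairwise_skew u v w; {a, b, c, d} \<subseteq> transversals {u, v, w};
      distinct [a, b, c, d]; l \<in> L; I l a; I l b; I l c\<rbrakk> \<Longrightarrow> I l d"

end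

theory Submission
  imports Defs
begin

text \<open>
  A regulus is recovered from any three of its lines. Let \<open>x, y, z\<close> be distinct lines of the regulus
  \<open>[uvw]\<close>. The lines \<open>u, v, w\<close> belong to \<open>[xyz]\<close>, the opposite regulus, and so every line that meets
  all of \<open>[xyz]\<close> lies in \<open>[uvw]\<close>; conversely, projectivity says that every line of \<open>[uvw]\<close> meets all
  of \<open>[xyz]\<close>. Thus \<open>[uvw] = [xyz]\<^sup>I\<close>, where the right-hand side no longer mentions \<open>u, v, w\<close>, and
  two reguli that share three lines coincide.
\<close>

lemma (in line_incidence) incident_commute: "a \<in> L \<Longrightarrow> b \<in> L \<Longrightarrow> I a b \<Longrightarrow> I b a"
  using incident_sym by (auto dest: symp_onD)

lemma (in line_incidence) regulus_subset_lines: "regulus R \<Longrightarrow> R \<subseteq> L"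
  by (auto simp: regulus_def transversals_def)

lemma (in projective_line_geometry) regulus_eq_double_transversals:
  assumes "regulus R" "{x, y, z} \<subseteq> R" "distinct [x, y, z]"
  shows "R = transversals (transversals {x, y, z})"
proof
  obtain u v w where uvw: "pairwise_skew u v w" and R: "R = transversals {u, v, w}"
    using assms(1) by (auto simp: regulus_def)
  have "{u, v, w} \<subseteq> transversals {x, y, z}"
    using assms(2) uvw incident_commute
    by (auto simp: R pairwise_skew_def skew_def transversals_def)
  then show "transversals (transversals {x, y, z}) \<subseteq> R"
    by (auto simp: R transversals_def)
  show "R \<subseteq> transversals (transversals {x, y, z})"
  proof
    fix l assume l: "l \<in> R"
    then have lL: "l \<in> L" using regulus_subset_lines[OF assms(1)] by blast
    have "I l m" if m: "m \<in> transversals {x, y, z}" for m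
    proof -
      have mL: "m \<in> L" and meets: "I m x" "I m y" "I m z"
        using m by (auto simp: transversals_def)
      have "I m l"
      proof (cases "l \<in> {x, y, z}")
        case True
        then show ?thesis using meets by auto
      next
        case False
        then show ?thesis
          using projectivity[OF uvw, of x y z l m] assms(2,3) l mL meets by (auto simp: R)
      qed
      then show ?thesis using incident_commute lL mL by blast
    qed
    with lL show "l \<in> transversals (transversals {x, y, z})"
      by (auto simp: transversals_def)
  qed
qed

theorem theorem8:
  fixes L :: "'a set" and I :: "'a \<Rightarrow> 'a \<Rightarrow> bool"
    and Pt Pl :: "'a \<Rightarrow> 'a \<Rightarrow> 'a set" and R1 R2 :: "'a set"
  assumes "projective_line_geometry L I Pt Pl"
    and "line_incidence.regulus L I R1"
    and "line_incidence.regulus L I R2"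
    and "R1 \<noteq> R2"
  shows "finite (R1 \<inter> R2) \<and> card (R1 \<inter> R2) \<le> 2"
proof (rule ccontr)
  assume "\<not> ?thesis"
  then obtain T where "T \<subseteq> R1 \<inter> R2" "card T = 3"
    by (metis infinite_arbitrarily_large not_less_eq_eq numeral_2_eq_2 numeral_3_eq_3
        obtain_subset_with_card_n)
  then obtain x y z where "{x, y, z} \<subseteq> R1" "{x, y, z} \<subseteq> R2" "distinct [x, y, z]"
    by (auto simp: card_3_iff)
  then have "R1 = R2"
    using projective_line_geometry.regulus_eq_double_transversals[OF assms(1)] assms(2,3)
    by metis
  with assms(4) show False ..
qed

end
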